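(* Let $g$ be a derivator, $\mathbb F\in\{\mathbb R,\mathbb C\}$ and $n\in\mathbb N$. Then $\operatorname{P}_n(\mathbb F)$ is a $g$-Haar space over $\mathbb R_+$, and thus over any $X\subset\mathbb R_+$ (where over $X$ one considers the restrictions to $X$ of the elements of $\operatorname{P}_n(\mathbb F)$).
   Context: $\mathbb N=\{0,1,2,\dots\}$. A derivator is a left-continuous nondecreasing function $g:\mathbb R\to\mathbb R$; $\mu_g$ is the Lebesgue–Stieltjes measure with $\mu_g([a,b))=g(b)-g(a)$. Write $g(t^+)$ for the right-hand limit and $D_g=\{t\in\mathbb R:g(t^+)>g(t)\}$. $\mathbb R_+$ is the disjoint union of $\mathbb R$ and a formal copy $\{t^+:t\in D_g\}$ of $D_g$; $g$ is extended to $\mathbb R_+$ by letting $g(t^+)$ be the right-hand limit of $g$ at $t$. $\mathbb R_+$ carries the pseudometric $d_g(x,y)=|g(x)-g(y)|$. Points $x,y\in\mathbb R_+$ are $g$-distinct if $g(x)\neq g(y)$. For $X\subset\mathbb R_+$, $\operatorname{UC}_g(X,\mathbb F)$ is the vector space of functions $f:X\to\mathbb F$ that are uniformly continuous with respect to $d_g$: for every $\varepsilon>0$ there is $\delta>0$ such that $|f(x)-f(y)|<\varepsilon$ for all $x,y\in X$ with $|g(x)-g(y)|<\delta$. Put $\int_x^y f\,d\mu_g=\int_{[x,y)}f\,d\mu_g$ if $y\ge x$ and $-\int_{[y,x)}f\,d\mu_g$ if $y<x$. For $x_0\in\mathbb R$ the $g$-monomials are $g_{x_0,0}(x)=1$ and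 $g_{x_0,k}(x)=k\int_{x_0}^x g_{x_0,k-1}\,d\mu_g$ for $k\ge1$, $x\in\mathbb R$. $\operatorname{P}_n(\mathbb F)$ is the $\mathbb F$-vector space spanned by $g_{x_0,0},\dots,g_{x_0,n}$ (independent of $x_0$); its elements are regarded as functions on $\mathbb R_+$, evaluated at $t^+$ ($t\in D_g$) by the right-hand limit at $t$. Let $X\subset\mathbb R_+$ and let $Y\subset\operatorname{UC}_g(X,\mathbb F)$ be a vector space of finite dimension $d$. $Y$ is a $g$-Haar space if, given any set $T=\{y_1,\dots,y_d\}\subset X$ of $d$ pairwise $g$-distinct points, the Vandermonde mapping $Y\to\mathbb F^d$, $f\mapsto(f(y_1),\dots,f(y_d))$, is an isomorphism of vector spaces.
   Formalization: The inclusion in UC_g(X,F) is false in general (g = id, n = 2: x² on the line), so it is claimed only for n ≤ 1 or g bounded on X; the rest of the g-Haar property, including the Vandermonde isomorphism, is claimed for every X. *)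

theory Defs
  imports "HOL-Analysis.Analysis" "HOL-Library.Function_Algebras"
begin

definition derivator :: "(real \<Rightarrow> real) \<Rightarrow> bool" where
  "derivator g \<longleftrightarrow> mono g \<and> (\<forall>x. continuous (at_left x) g)"

(* interval_measure F is built for right-continuous F and half-open intervals {a<..b};
   reflecting at the origin gives the measure with {a..<b} \<mapsto> g b - g a. *)
definition LS_measure :: "(real \<Rightarrow> real) \<Rightarrow> real measure" where
  "LS_measure g = distr (interval_measure (\<lambda>x. - g (- x))) borel uminus"

lemma emeasure_LS_measure:
  assumes "derivator g" "a \<le> b"
  shows "emeasure (LS_measure g) {a..<b} = ennreal (g b - g a)"
proof -
  let ?F = "\<lambda>x. - g (- x)"
  have mono: "\<And>x y. x \<le> y \<Longrightarrow> ?F x \<le> ?F y"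
    using assms(1) by (auto simp: derivator_def mono_def)
  have cont: "continuous (at_right c) ?F" for c
  proof -
    have "(g \<longlongrightarrow> g (- c)) (at_left (- c))"
      using assms(1) by (simp add: derivator_def continuous_within)
    then have "((\<lambda>x. g (- x)) \<longlongrightarrow> g (- c)) (at_right c)"
      by (simp add: at_left_minus filterlim_filtermap)
    then show ?thesis
      by (auto simp: continuous_within intro: tendsto_minus)
  qed
  have "uminus -` {a..<b} = {- b<..- a}"
    by auto
  moreover have "emeasure (interval_measure ?F) {- b<..- a} = ?F (- a) - ?F (- b)"
    by (rule emeasure_interval_measure_Ioc) (use assms(2) mono cont in auto)
  ultimately show ?thesis
    by (simp add: LS_measure_def emeasure_distr)
qed

definition g_integral :: "(real \<Rightarrow> real) \<Rightarrow> real \<Rightarrow> real \<Rightarrow> (real \<Rightarrow> real) \<Rightarrow> real" where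
  "g_integral g x y f =
     (if x \<le> y then (LINT t:{x..<y}|LS_measure g. f t)
      else - (LINT t:{y..<x}|LS_measure g. f t))"

primrec g_monomial :: "(real \<Rightarrow> real) \<Rightarrow> real \<Rightarrow> nat \<Rightarrow> real \<Rightarrow> real" where
  "g_monomial g x0 0 = (\<lambda>x. 1)"
| "g_monomial g x0 (Suc k) = (\<lambda>x. real (Suc k) * g_integral g x0 x (g_monomial g x0 k))"

definition jumps :: "(real \<Rightarrow> real) \<Rightarrow> real set" where
  "jumps g = {t. Lim (at_right t) g > g t}"

datatype point = Pt real | Plus real

definition Rplus :: "(real \<Rightarrow> real) \<Rightarrow> point set" where
  "Rplus g = range Pt \<union> Plus ` jumps g"

fun extend :: "(real \<Rightarrow> 'a::t2_space) \<Rightarrow> point \<Rightarrow> 'a" where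
  "extend f (Pt x) = f x"
| "extend f (Plus t) = Lim (at_right t) f"

(* A function X \<rightarrow> F is represented by its extension by zero, so that the functions on X form
   a subspace of the space of all functions on the ambient type; F^d is fun_on {..<d}. *)
definition fun_on :: "'b set \<Rightarrow> ('b \<Rightarrow> 'a::zero) set" where
  "fun_on X = {f. \<forall>x. x \<notin> X \<longrightarrow> f x = 0}"

definition restr :: "'b set \<Rightarrow> ('b \<Rightarrow> 'a::zero) \<Rightarrow> 'b \<Rightarrow> 'a" where
  "restr X f = (\<lambda>x. if x \<in> X then f x else 0)"

definition fun_scale :: "'a::field \<Rightarrow> ('b \<Rightarrow> 'a) \<Rightarrow> 'b \<Rightarrow> 'a" where
  "fun_scale c f = (\<lambda>x. c * f x)"

interpretation fun_vs: vector_space "fun_scale :: 'a::field \<Rightarrow> ('b \<Rightarrow> 'a) \<Rightarrow> 'b \<Rightarrow> 'a"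
  by unfold_locales (auto simp: fun_scale_def algebra_simps fun_eq_iff)

(* Up to isomorphism the real_normed_fields are exactly the real and the complex numbers. *)
definition UC :: "(real \<Rightarrow> real) \<Rightarrow> point set \<Rightarrow> (point \<Rightarrow> 'a::real_normed_field) set" where
  "UC g X = {f \<in> fun_on X. \<forall>\<epsilon>>0. \<exists>\<delta>>0. \<forall>x\<in>X. \<forall>y\<in>X.
     \<bar>extend g x - extend g y\<bar> < \<delta> \<longrightarrow> norm (f x - f y) < \<epsilon>}"

definition g_polys :: "(real \<Rightarrow> real) \<Rightarrow> real \<Rightarrow> nat \<Rightarrow> (real \<Rightarrow> 'a::real_normed_field) set" where
  "g_polys g x0 n = fun_vs.span ((\<lambda>k x. of_real (g_monomial g x0 k x)) ` {..n})"

definition g_polys_on ::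
  "(real \<Rightarrow> real) \<Rightarrow> real \<Rightarrow> nat \<Rightarrow> point set \<Rightarrow> (point \<Rightarrow> 'a::real_normed_field) set" where
  "g_polys_on g x0 n X = (\<lambda>f. restr X (extend f)) ` g_polys g x0 n"

definition vandermonde :: "nat \<Rightarrow> (nat \<Rightarrow> point) \<Rightarrow> (point \<Rightarrow> 'a::zero) \<Rightarrow> nat \<Rightarrow> 'a" where
  "vandermonde d y f = restr {..<d} (\<lambda>i. f (y i))"

(* All requirements on a g-Haar space except the inclusion in UC g X. They are separated because
   this inclusion fails on some X where g is unbounded, see g_polys_not_UC: for g = id the
   square function is not uniformly continuous on the line. *)
definition haar_condition ::
  "(real \<Rightarrow> real) \<Rightarrow> point set \<Rightarrow> (point \<Rightarrow> 'a::real_normed_field) set \<Rightarrow> bool" where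
  "haar_condition g X Y \<longleftrightarrow>
     Y \<subseteq> fun_on X \<and> fun_vs.subspace Y \<and> (\<exists>B. finite B \<and> fun_vs.span B = Y) \<and>
     (let d = fun_vs.dim Y in
       \<forall>y. (\<forall>i<d. y i \<in> X) \<and> inj_on (\<lambda>i. extend g (y i)) {..<d} \<longrightarrow>
         Vector_Spaces.linear fun_scale fun_scale (vandermonde d y :: (point \<Rightarrow> 'a) \<Rightarrow> nat \<Rightarrow> 'a) \<and>
         bij_betw (vandermonde d y) Y (fun_on {..<d}))"

definition g_Haar ::
  "(real \<Rightarrow> real) \<Rightarrow> point set \<Rightarrow> (point \<Rightarrow> 'a::real_normed_field) set \<Rightarrow> bool" where
  "g_Haar g X Y \<longleftrightarrow> Y \<subseteq> UC g X \<and> haar_condition g X Y"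

lemma g_monomial_id: "g_monomial (\<lambda>x. x) 0 k x = x ^ k"
proof (induction k arbitrary: x)
  case 0
  show ?case by simp
next
  case (Suc k)
  have M: "LS_measure (\<lambda>x. x) = lborel"
    unfolding LS_measure_def using lborel_distr_uminus
    by (simp only: minus_minus lborel_eq_real[symmetric])
  have eq: "(LINT t:{a..<b}|lborel. t ^ k) = (b ^ Suc k - a ^ Suc k) / real (Suc k)"
    if "a \<le> b" for a b :: real
  proof -
    have "(LINT t:{a..<b}|lborel. t ^ k) = (LINT t:{a..b}|lborel. t ^ k)"
    proof (rule set_integral_cong_set)
      have "AE t in lborel. t \<noteq> b" by (rule AE_lborel_singleton)
      then show "AE t in lborel. (t \<in> {a..b}) = (t \<in> {a..<b})"
        by eventually_elim auto
    qed (auto simp: set_borel_measurable_def)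
    also have "\<dots> = (b ^ Suc k - a ^ Suc k) / real (Suc k)"
      using integral_power[OF that] by (simp add: set_lebesgue_integral_def mult.commute)
    finally show ?thesis .
  qed
  have "g_integral (\<lambda>x. x) 0 x (\<lambda>t. t ^ k) = x ^ Suc k / real (Suc k)"
    using eq[of 0 x] eq[of x 0] by (simp add: g_integral_def M)
  moreover have "g_monomial (\<lambda>x. x) 0 k = (\<lambda>t. t ^ k)"
    using Suc.IH by (intro HOL.ext)
  ultimately show ?case by simp
qed

lemma g_polys_not_UC:
  fixes g :: "real \<Rightarrow> real"
  defines "g \<equiv> (\<lambda>x. x)"
  shows "\<not> (g_polys_on g 0 2 (Rplus g) :: (point \<Rightarrow> 'a::real_normed_field) set) \<subseteq> UC g (Rplus g)"
proof
  let ?h = "\<lambda>x. of_real (x\<^sup>2) :: 'a"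
  assume sub: "(g_polys_on g 0 2 (Rplus g) :: (point \<Rightarrow> 'a) set) \<subseteq> UC g (Rplus g)"
  have "?h \<in> (\<lambda>k x. of_real (g_monomial g 0 k x)) ` {..2}"
    unfolding g_def g_monomial_id by blast
  then have "?h \<in> g_polys g 0 2"
    unfolding g_polys_def by (rule fun_vs.span_base)
  then have "restr (Rplus g) (extend ?h) \<in> UC g (Rplus g)"
    using sub by (auto simp: g_polys_on_def)
  then obtain \<delta> where \<delta>: "\<delta> > 0" "\<forall>x\<in>Rplus g. \<forall>y\<in>Rplus g. \<bar>extend g x - extend g y\<bar> < \<delta> \<longrightarrow>
      norm (restr (Rplus g) (extend ?h) x - restr (Rplus g) (extend ?h) y) < 1"
    unfolding UC_def by (auto dest!: spec[of _ 1])
  let ?x = "1 / \<delta>" and ?y = "1 / \<delta> + \<delta> / 2"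
  have "norm (?h ?x - ?h ?y) < 1"
    using \<delta>(2)[rule_format, of "Pt ?x" "Pt ?y"] \<delta>(1) by (simp add: Rplus_def restr_def g_def)
  moreover have "norm (?h ?x - ?h ?y) = \<bar>?x\<^sup>2 - ?y\<^sup>2\<bar>"
    by (metis of_real_diff norm_of_real)
  moreover have "?y\<^sup>2 - ?x\<^sup>2 = 1 + \<delta>\<^sup>2 / 4"
    using \<delta>(1) by (simp add: power2_eq_square field_simps)
  moreover have "0 \<le> \<delta>\<^sup>2"
    by simp
  ultimately show False
    by linarith
qed

end

(* A discrete form of Rolle's theorem: let f be a real g-polynomial of degree n whose signs at n+1
   points with increasing g-values alternate weakly. Its increments over adjacent points are
   integrals of its g-derivative, hence the g-derivative has weakly alternating signs at n points
   with increasing g-values. By induction the leading coefficient of f has a definite sign unless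
   f = 0; applied to f and -f, this shows that n+1 g-distinct zeros force all coefficients to
   vanish. Interpolation at at most n+1 points follows, and with it the Haar property: the
   dimension on X is the minimum of n+1 and the number of g-distinct points of X, and in the second
   case a g-polynomial on X is determined by one point per value of g, because it is Lipschitz with
   respect to g on sets where g is bounded. *)

theory Submission
  imports Defs
begin

section \<open>Function spaces\<close>

lemma set_integral_lincomb:
  fixes c :: "'i \<Rightarrow> real" and h :: "'i \<Rightarrow> 'b \<Rightarrow> real"
  assumes "finite A" "\<And>k. k \<in> A \<Longrightarrow> set_integrable M S (h k)"
  shows "set_integrable M S (\<lambda>x. \<Sum>k\<in>A. c k * h k x) \<and>
    (LINT x:S|M. (\<Sum>k\<in>A. c k * h k x)) = (\<Sum>k\<in>A. c k * (LINT x:S|M. h k x))"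
  using assms
proof (induction A rule: finite_induct)
  case empty
  then show ?case
    by (simp add: set_integrable_def set_lebesgue_integral_def)
next
  case (insert a A)
  then have "set_integrable M S (\<lambda>x. c a * h a x)"
    and "set_integrable M S (\<lambda>x. \<Sum>k\<in>A. c k * h k x)"
    by (auto intro: set_integrable_mult_right)
  from set_integral_add[OF this] insert show ?case
    by simp
qed

lemma sum_fun_apply:
  fixes f :: "'i \<Rightarrow> 'b \<Rightarrow> 'a::comm_monoid_add"
  shows "(\<Sum>a\<in>A. f a) x = (\<Sum>a\<in>A. f a x)"
  by (induction A rule: infinite_finite_induct) auto

lemma fun_vs_span_image:
  fixes f :: "'i \<Rightarrow> 'b \<Rightarrow> 'a::field"
  assumes "finite A"
  shows "fun_vs.span (f ` A) = range (\<lambda>c x. \<Sum>a\<in>A. c a * f a x)"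
proof
  show "fun_vs.span (f ` A) \<subseteq> range (\<lambda>c x. \<Sum>a\<in>A. c a * f a x)"
  proof (rule fun_vs.span_minimal)
    show "f ` A \<subseteq> range (\<lambda>c x. \<Sum>a\<in>A. c a * f a x)"
    proof
      fix h
      assume "h \<in> f ` A"
      then obtain b where "b \<in> A" "h = f b"
        by auto
      then have "h = (\<lambda>x. \<Sum>a\<in>A. (if a = b then 1 else 0) * f a x)"
        using assms by (simp add: if_distrib[of "\<lambda>u. u * _"] cong: if_cong)
      then show "h \<in> range (\<lambda>c x. \<Sum>a\<in>A. c a * f a x)"
        by (intro range_eqI[of _ _ "\<lambda>a. if a = b then 1 else 0"]) simp
    qed
    show "fun_vs.subspace (range (\<lambda>c x. \<Sum>a\<in>A. c a * f a x))"
      unfolding fun_vs.subspace_def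
    proof (intro conjI ballI allI)
      show "0 \<in> range (\<lambda>c x. \<Sum>a\<in>A. c a * f a x)"
        by (rule range_eqI[of _ _ "\<lambda>_. 0"]) (simp add: fun_eq_iff)
      fix u v :: "'b \<Rightarrow> 'a" and r :: 'a
      assume "u \<in> range (\<lambda>c x. \<Sum>a\<in>A. c a * f a x)"
      then obtain c where c: "u = (\<lambda>x. \<Sum>a\<in>A. c a * f a x)"
        by auto
      show "fun_scale r u \<in> range (\<lambda>c x. \<Sum>a\<in>A. c a * f a x)"
        by (rule range_eqI[of _ _ "\<lambda>a. r * c a"])
          (simp add: c fun_scale_def sum_distrib_left mult.assoc)
      assume "v \<in> range (\<lambda>c x. \<Sum>a\<in>A. c a * f a x)"
      then obtain e where e: "v = (\<lambda>x. \<Sum>a\<in>A. e a * f a x)"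
        by auto
      show "u + v \<in> range (\<lambda>c x. \<Sum>a\<in>A. c a * f a x)"
        by (rule range_eqI[of _ _ "\<lambda>a. c a + e a"])
          (simp add: c e fun_eq_iff sum.distrib distrib_right)
    qed
  qed
  show "range (\<lambda>c x. \<Sum>a\<in>A. c a * f a x) \<subseteq> fun_vs.span (f ` A)"
  proof clarify
    fix c :: "'i \<Rightarrow> 'a"
    have "(\<Sum>a\<in>A. fun_scale (c a) (f a)) \<in> fun_vs.span (f ` A)"
      by (intro fun_vs.span_sum fun_vs.span_scale fun_vs.span_base) auto
    also have "(\<Sum>a\<in>A. fun_scale (c a) (f a)) = (\<lambda>x. \<Sum>a\<in>A. c a * f a x)"
      by (simp add: fun_eq_iff sum_fun_apply fun_scale_def)
    finally show "(\<lambda>x. \<Sum>a\<in>A. c a * f a x) \<in> fun_vs.span (f ` A)" .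
  qed
qed

lemma vandermonde_linear:
  "Vector_Spaces.linear fun_scale fun_scale
     (vandermonde d y :: (point \<Rightarrow> 'a::field) \<Rightarrow> nat \<Rightarrow> 'a)"
  unfolding Vector_Spaces.linear_iff
  by (auto simp: fun_vs.vector_space_axioms vandermonde_def restr_def fun_scale_def)

text \<open>\<open>zero\<close> makes the Vandermonde mapping injective and \<open>interp\<close>
  makes it surjective. The Lagrange functions \<open>l j\<close> supplied by \<open>interp\<close>
  form a basis, which fixes the dimension that \<open>haar_condition\<close> refers to.\<close>

lemma unisolvent:
  fixes Y :: "(point \<Rightarrow> 'a::field) set"
  assumes Y: "fun_vs.subspace Y"
    and zero: "\<And>f. f \<in> Y \<Longrightarrow> (\<And>i. i < d \<Longrightarrow> f (y i) = 0) \<Longrightarrow> f = 0"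
    and interp: "\<And>b. \<exists>f\<in>Y. \<forall>i<d. f (y i) = b i"
  shows "bij_betw (vandermonde d y) Y (fun_on {..<d})" and "fun_vs.dim Y = d"
proof -
  have eq: "u = v" if "u \<in> Y" "v \<in> Y" "\<And>i. i < d \<Longrightarrow> u (y i) = v (y i)" for u v
    using zero[of "u - v"] fun_vs.subspace_diff[OF Y that(1,2)] that(3) by simp
  show "bij_betw (vandermonde d y) Y (fun_on {..<d})"
    unfolding bij_betw_def
  proof
    show "inj_on (vandermonde d y) Y"
    proof (rule inj_onI)
      fix u v
      assume uv: "u \<in> Y" "v \<in> Y" "vandermonde d y u = vandermonde d y v"
      have "u (y i) = v (y i)" if "i < d" for i
        using fun_cong[OF uv(3), of i] that by (simp add: vandermonde_def restr_def)
      with uv show "u = v"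
        by (intro eq)
    qed
    show "vandermonde d y ` Y = fun_on {..<d}"
    proof
      show "vandermonde d y ` Y \<subseteq> fun_on {..<d}"
        by (auto simp: vandermonde_def restr_def fun_on_def)
      show "fun_on {..<d} \<subseteq> vandermonde d y ` Y"
      proof
        fix b :: "nat \<Rightarrow> 'a"
        assume b: "b \<in> fun_on {..<d}"
        obtain f where f: "f \<in> Y" "\<forall>i<d. f (y i) = b i"
          using interp by blast
        then have "b = vandermonde d y f"
          using b by (auto simp: vandermonde_def restr_def fun_on_def fun_eq_iff)
        then show "b \<in> vandermonde d y ` Y"
          using f by blast
      qed
    qed
  qed
  obtain l where l: "\<And>j. l j \<in> Y" "\<And>i j. i < d \<Longrightarrow> l j (y i) = (if i = j then 1 else 0)"
    using interp[of "\<lambda>i. if i = j then 1 else 0" for j] by metis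
  have inj: "inj_on l {..<d}"
  proof (rule inj_onI)
    fix i j
    assume "i \<in> {..<d}" "l i = l j"
    then show "i = j"
      using l(2)[of i i] l(2)[of i j] by (auto split: if_splits)
  qed
  show "fun_vs.dim Y = d"
  proof (rule fun_vs.dim_unique[of "l ` {..<d}"])
    show "l ` {..<d} \<subseteq> Y"
      using l(1) by auto
    show "card (l ` {..<d}) = d"
      using inj by (simp add: card_image)
    \<comment> \<open>Evaluation at \<open>y i\<close> reads off the \<open>i\<close>-th
      coefficient; this gives both spanning and independence.\<close>
    have comb: "(\<Sum>j<d. fun_scale (a j) (l j)) (y i) = a i" if "i < d" for a i
    proof -
      have "(\<Sum>j<d. fun_scale (a j) (l j)) (y i) = (\<Sum>j<d. if j = i then a j else 0)"
        unfolding sum_fun_apply fun_scale_def using that by (intro sum.cong) (auto simp: l(2))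
      then show ?thesis
        using that by simp
    qed
    show "Y \<subseteq> fun_vs.span (l ` {..<d})"
    proof
      fix f
      assume f: "f \<in> Y"
      have "f = (\<Sum>j<d. fun_scale (f (y j)) (l j))"
        by (intro eq f fun_vs.subspace_sum[OF Y] fun_vs.subspace_scale[OF Y] l(1))
          (simp add: comb)
      also have "\<dots> \<in> fun_vs.span (l ` {..<d})"
        by (intro fun_vs.span_sum fun_vs.span_scale fun_vs.span_base) auto
      finally show "f \<in> fun_vs.span (l ` {..<d})" .
    qed
    show "fun_vs.independent (l ` {..<d})"
    proof (rule fun_vs.independent_if_scalars_zero)
      fix u x
      assume sum: "(\<Sum>v\<in>l ` {..<d}. fun_scale (u v) v) = 0" and "x \<in> l ` {..<d}"
      then obtain i where i: "i < d" "x = l i"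
        by auto
      have "(\<Sum>j<d. fun_scale (u (l j)) (l j)) = 0"
        using sum by (simp add: sum.reindex[OF inj])
      then show "u x = 0"
        using comb[OF i(1), of "\<lambda>j. u (l j)"] i by simp
    qed simp
  qed
qed

section \<open>Integrals with respect to a derivator\<close>

text \<open>Increments of primitives from \<open>p\<close> to \<open>q\<close> are integrals over \<open>below q - below p\<close>.\<close>

fun below :: "point \<Rightarrow> real set" where
  "below (Pt a) = {..<a}"
| "below (Plus a) = {..a}"

lemma below_linear: "below p \<subseteq> below q \<or> below q \<subseteq> below p"
  by (cases p; cases q) auto

lemma sets_below [measurable]: "below p \<in> sets borel"
  by (cases p) auto

lemma notin_below: "z \<notin> below p \<Longrightarrow> below p \<subseteq> below (Pt z)"
  by (cases p) auto

text \<open>The bound is required where \<open>g\<close> is bounded rather than on bounded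
  intervals: uniform continuity is measured by \<open>g\<close>, and \<open>g\<close> may be bounded
  on unbounded sets.\<close>

definition admissible :: "(real \<Rightarrow> real) \<Rightarrow> (real \<Rightarrow> real) \<Rightarrow> bool" where
  "admissible g h \<longleftrightarrow> h \<in> borel_measurable borel \<and> (\<forall>R. \<exists>M. \<forall>x. \<bar>g x\<bar> \<le> R \<longrightarrow> \<bar>h x\<bar> \<le> M)"

text \<open>\<open>h\<close> acts as a \<open>g\<close>-derivative of \<open>F\<close>. Only
  increments enter, so no base point has to be carried along.\<close>

definition primitive :: "(real \<Rightarrow> real) \<Rightarrow> (real \<Rightarrow> real) \<Rightarrow> (real \<Rightarrow> real) \<Rightarrow> bool" where
  "primitive g h F \<longleftrightarrow> admissible g h \<and>
     (\<forall>a b. a \<le> b \<longrightarrow> F b - F a = (LINT t:{a..<b}|LS_measure g. h t))"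

lemma sets_LS_measure [measurable_cong, simp]: "sets (LS_measure g) = sets borel"
  unfolding LS_measure_def by (rule sets_distr)

lemma space_LS_measure [simp]: "space (LS_measure g) = UNIV"
  unfolding LS_measure_def by (simp only: space_distr space_borel)

context
  fixes g :: "real \<Rightarrow> real"
  assumes g: "derivator g"
begin

lemma derivator_mono: "x \<le> y \<Longrightarrow> g x \<le> g y"
  using g by (auto simp: derivator_def mono_def)

section \<open>Integrability and primitives for the Stieltjes measure\<close>

lemma admissible_integrable:
  assumes "admissible g h" "A \<in> sets borel" "A \<subseteq> {a..<b}"
  shows "set_integrable (LS_measure g) A h"
proof -
  obtain M where M: "\<And>x. \<bar>g x\<bar> \<le> max \<bar>g a\<bar> \<bar>g b\<bar> \<Longrightarrow> \<bar>h x\<bar> \<le> M"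
    using assms(1) unfolding admissible_def by blast
  have [measurable]: "h \<in> borel_measurable borel"
    using assms(1) by (simp add: admissible_def)
  have "set_integrable (LS_measure g) {a..<b} h"
    unfolding set_integrable_def
  proof (rule integrableI_bounded_set_indicator[where B = M])
    show "emeasure (LS_measure g) {a..<b} < \<infinity>"
      by (cases "a \<le> b") (auto simp: emeasure_LS_measure[OF g])
    have "norm (h x) \<le> M" if "x \<in> {a..<b}" for x
    proof -
      have "g a \<le> g x" "g x \<le> g b"
        using that by (auto intro: derivator_mono)
      then show ?thesis
        using M[of x] by auto
    qed
    then show "AE x in LS_measure g. x \<in> {a..<b} \<longrightarrow> norm (h x) \<le> M"
      by auto
  qed measurable
  then show ?thesis
    by (rule set_integrable_subset) (use assms in auto)
qed

lemma primitive_g: "primitive g (\<lambda>_. 1) g"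
  unfolding primitive_def
proof (intro conjI allI impI)
  show "admissible g (\<lambda>_. 1)"
    by (auto simp: admissible_def)
  fix a b :: real
  assume "a \<le> b"
  then show "g b - g a = (LINT t:{a..<b}|LS_measure g. 1)"
    using derivator_mono[of a b]
    by (simp add: set_lebesgue_integral_def measure_def emeasure_LS_measure[OF g])
qed

lemma primitive_g_integral:
  assumes h: "admissible g h"
  shows "primitive g h (\<lambda>x. g_integral g x0 x h)"
  unfolding primitive_def
proof (intro conjI allI impI)
  have split: "(LINT t:{u..<w}|LS_measure g. h t) =
      (LINT t:{u..<v}|LS_measure g. h t) + (LINT t:{v..<w}|LS_measure g. h t)"
    if "u \<le> v" "v \<le> w" for u v w
  proof -
    have "{u..<w} = {u..<v} \<union> {v..<w}"
      using that by auto
    then show ?thesis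
      by (simp, intro set_integral_Un admissible_integrable[OF h, where a = u and b = w])
        (use that in auto)
  qed
  fix a b :: real
  assume "a \<le> b"
  then consider "x0 \<le> a" | "a < x0" "x0 \<le> b" | "b < x0"
    by linarith
  then show "g_integral g x0 b h - g_integral g x0 a h = (LINT t:{a..<b}|LS_measure g. h t)"
  proof cases
    case 1
    then show ?thesis
      using split[of x0 a b] \<open>a \<le> b\<close> by (simp add: g_integral_def)
  next
    case 2
    then show ?thesis
      using split[of a x0 b] by (simp add: g_integral_def)
  next
    case 3
    then show ?thesis
      using split[of a b x0] \<open>a \<le> b\<close> by (simp add: g_integral_def)
  qed
qed (fact h)

text \<open>The intervals \<open>{b..<S n}\<close> shrink to \<open>{b}\<close>, so what remains in
  the limit is the contribution of the atom at \<open>b\<close>.\<close>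

lemma primitive_tendsto_right:
  assumes "primitive g h F"
  shows "(F \<longlongrightarrow> F b + (LINT t:{b}|LS_measure g. h t)) (at_right b)"
proof (rule tendsto_at_right_sequentially[of b "b + 1"])
  fix S :: "nat \<Rightarrow> real"
  assume S: "\<And>n. b < S n" "\<And>n. S n < b + 1" "decseq S" "S \<longlonglongrightarrow> b"
  have h: "admissible g h"
    using assms by (simp add: primitive_def)
  have "(\<lambda>n. LINT t:{b..<S n}|LS_measure g. h t) \<longlonglongrightarrow>
      (LINT t:(\<Inter>n. {b..<S n})|LS_measure g. h t)"
  proof (rule set_integral_cont_down)
    show "decseq (\<lambda>n. {b..<S n})"
      using S(3) by (fastforce simp: decseq_def)
    show "set_integrable (LS_measure g) {b..<S 0} h"
      by (rule admissible_integrable[OF h _ subset_refl]) auto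
  qed auto
  moreover have "(\<Inter>n. {b..<S n}) = {b}"
  proof -
    have "x \<le> b" if "\<And>n. x < S n" for x
      by (rule LIMSEQ_le_const[OF S(4)]) (use that in \<open>auto intro: less_imp_le\<close>)
    then show ?thesis
      using S(1) by force
  qed
  moreover have "F (S n) = F b + (LINT t:{b..<S n}|LS_measure g. h t)" for n
    using assms S(1)[of n] by (simp add: primitive_def algebra_simps)
  ultimately show "(\<lambda>n. F (S n)) \<longlonglongrightarrow> F b + (LINT t:{b}|LS_measure g. h t)"
    by (auto intro!: tendsto_intros)
qed simp

text \<open>Certifies that \<open>Lim\<close> in \<open>extend\<close> denotes an actual limit, at
  every \<open>b\<close> and not only at jumps of \<open>g\<close>.\<close>

lemma primitive_tendsto_extend:
  assumes "primitive g h F"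
  shows "(F \<longlongrightarrow> extend F (Plus b)) (at_right b)"
  using primitive_tendsto_right[OF assms, of b]
    tendsto_Lim[OF trivial_limit_at_right_real primitive_tendsto_right[OF assms, of b]] by simp

text \<open>\<open>below (Plus b)\<close> contains \<open>b\<close>, so the atom from
  \<open>primitive_tendsto_right\<close> is absorbed into the domain of integration and one formula
  covers both kinds of points.\<close>

lemma primitive_extend_diff:
  assumes F: "primitive g h F" and le: "below p \<subseteq> below q"
  shows "extend F q - extend F p = (LINT t:below q - below p|LS_measure g. h t)"
    and "set_integrable (LS_measure g) (below q - below p) h"
proof -
  have h: "admissible g h"
    using F by (simp add: primitive_def)
  \<comment> \<open>Both values are compared with \<open>F a\<close> for a real base point
    \<open>a\<close> that is not to the right of either point.\<close>
  have "\<exists>a. \<forall>r\<in>{p, q}. {..<a} \<subseteq> below r"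
  proof -
    obtain u where u: "{..<u} \<subseteq> below p"
      by (cases p) (auto intro: that[of "case p of Pt x \<Rightarrow> x | Plus x \<Rightarrow> x"])
    then show ?thesis
      using le by blast
  qed
  then obtain a where a: "{..<a} \<subseteq> below p" "{..<a} \<subseteq> below q"
    by auto
  have bd: "\<exists>b. below r - {..<a} \<subseteq> {a..<b}" for r
  proof (cases r)
    case (Pt x)
    then show ?thesis by (intro exI[of _ x]) auto
  next
    case (Plus x)
    then show ?thesis by (intro exI[of _ "x + 1"]) auto
  qed
  have int: "set_integrable (LS_measure g) A h"
    if "A \<in> sets borel" "A \<subseteq> below r - {..<a}" for A r
    using bd[of r] admissible_integrable[OF h that(1)] that(2) by blast
  have base: "extend F r = F a + (LINT t:below r - {..<a}|LS_measure g. h t)"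
    if r: "{..<a} \<subseteq> below r" for r
  proof (cases r)
    case (Pt b)
    then have "a \<le> b" "below r - {..<a} = {a..<b}"
      using r by auto
    then show ?thesis
      using F Pt by (simp add: primitive_def algebra_simps)
  next
    case (Plus b)
    have "a \<le> b"
      by (rule dense_le) (use r Plus in auto)
    with Plus have ab: "a \<le> b" "below r - {..<a} = {a..<b} \<union> {b}"
      by auto
    have "extend F r = F b + (LINT t:{b}|LS_measure g. h t)"
      using primitive_tendsto_right[OF F, of b] tendsto_Lim[OF trivial_limit_at_right_real] Plus
      by auto
    moreover have "F b = F a + (LINT t:{a..<b}|LS_measure g. h t)"
      using F ab by (simp add: primitive_def algebra_simps)
    moreover have "(LINT t:{a..<b} \<union> {b}|LS_measure g. h t) =
        (LINT t:{a..<b}|LS_measure g. h t) + (LINT t:{b}|LS_measure g. h t)"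
      by (intro set_integral_Un int[of _ r]) (use ab in auto)
    ultimately show ?thesis
      using ab by simp
  qed
  show int_pq: "set_integrable (LS_measure g) (below q - below p) h"
    by (rule int[of _ q]) (use a in auto)
  have "(LINT t:(below p - {..<a}) \<union> (below q - below p)|LS_measure g. h t) =
      (LINT t:below p - {..<a}|LS_measure g. h t) + (LINT t:below q - below p|LS_measure g. h t)"
    by (intro set_integral_Un int_pq int[of _ p]) auto
  moreover have "(below p - {..<a}) \<union> (below q - below p) = below q - {..<a}"
    using a le by blast
  ultimately show "extend F q - extend F p = (LINT t:below q - below p|LS_measure g. h t)"
    using base[OF a(1)] base[OF a(2)] by simp
qed

section \<open>Measure of the sets between two points, and Lipschitz bounds\<close>

lemma measure_below_diff:
  assumes "below p \<subseteq> below q"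
  shows "emeasure (LS_measure g) (below q - below p) = ennreal (extend g q - extend g p)"
    and "extend g p \<le> extend g q"
proof -
  have i: "set_integrable (LS_measure g) (below q - below p) (\<lambda>_. 1::real)"
    and e: "extend g q - extend g p = (LINT t:below q - below p|LS_measure g. 1)"
    using primitive_extend_diff[OF primitive_g assms] by auto
  have "emeasure (LS_measure g) (below q - below p) < \<infinity>"
    using i by (simp add: set_integrable_def integrable_indicator_iff)
  then have "emeasure (LS_measure g) (below q - below p) =
      ennreal (measure (LS_measure g) (below q - below p))"
    by (intro emeasure_eq_ennreal_measure) auto
  moreover have "extend g q - extend g p = measure (LS_measure g) (below q - below p)"
    using e by (simp add: set_lebesgue_integral_def)
  ultimately show "emeasure (LS_measure g) (below q - below p) = ennreal (extend g q - extend g p)"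
    and "extend g p \<le> extend g q"
    by (simp, metis diff_ge_0_iff_ge measure_nonneg)
qed

lemma below_subset_of_less:
  assumes "extend g p < extend g q"
  shows "below p \<subseteq> below q"
  using below_linear[of p q] measure_below_diff(2)[of q p] assms by auto

text \<open>By monotonicity, \<open>g\<close> stays within \<open>R\<close> between the two points,
  so there \<open>h\<close> is bounded by \<open>M\<close>; the measure of the domain of integration
  is the \<open>g\<close>-distance.\<close>

lemma primitive_lipschitz_extend:
  assumes F: "primitive g h F" and M: "\<And>x. \<bar>g x\<bar> \<le> R \<Longrightarrow> \<bar>h x\<bar> \<le> M"
    and pq: "\<bar>extend g p\<bar> \<le> R" "\<bar>extend g q\<bar> \<le> R"
  shows "\<bar>extend F p - extend F q\<bar> \<le> M * \<bar>extend g p - extend g q\<bar>"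
proof -
  have *: "\<bar>extend F q - extend F p\<bar> \<le> M * \<bar>extend g q - extend g p\<bar>"
    if sub: "below p \<subseteq> below q" and pq: "\<bar>extend g p\<bar> \<le> R" "\<bar>extend g q\<bar> \<le> R" for p q
  proof -
    let ?I = "below q - below p"
    have bnd: "\<bar>h z\<bar> \<le> M" if "z \<in> ?I" for z
    proof -
      have "below p \<subseteq> below (Pt z)" "below (Pt z) \<subseteq> below q"
        using that by (cases p; cases q; auto)+
      from measure_below_diff(2)[OF this(1)] measure_below_diff(2)[OF this(2)]
      have "\<bar>g z\<bar> \<le> R"
        using pq by (simp add: abs_le_iff)
      then show ?thesis
        by (rule M)
    qed
    note int = primitive_extend_diff(2)[OF F sub] and one = primitive_extend_diff[OF primitive_g sub]
    have "\<bar>LINT t:?I|LS_measure g. h t\<bar> \<le> (LINT t:?I|LS_measure g. \<bar>h t\<bar>)"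
      using set_integral_norm_bound[OF int] by simp
    also have "\<dots> \<le> (LINT t:?I|LS_measure g. M * 1)"
      using int one(2) bnd
      by (intro set_integral_mono set_integrable_mult_right set_integrable_abs) simp_all
    also have "\<dots> = M * (extend g q - extend g p)"
      by (simp only: set_integral_mult_right one(1))
    finally show ?thesis
      using primitive_extend_diff(1)[OF F sub] measure_below_diff(2)[OF sub] by simp
  qed
  show ?thesis
    using below_linear[of p q] *[OF _ pq] *[OF _ pq(2,1)] by (auto simp: abs_minus_commute)
qed

text \<open>By the Lipschitz bound \<open>F\<close> is continuous wherever \<open>g\<close> is, and
  a monotone function has only countably many discontinuities; hence measurability. Admissibility
  can thus be passed up through iterated integrals.\<close>

lemma primitive_admissible:
  assumes F: "primitive g h F"
  shows "admissible g F"
  unfolding admissible_def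
proof (intro conjI allI)
  have adm: "\<exists>M. \<forall>x. \<bar>g x\<bar> \<le> R \<longrightarrow> \<bar>h x\<bar> \<le> M" for R
    using F by (simp add: primitive_def admissible_def)
  have lip: "\<bar>F x - F y\<bar> \<le> M * \<bar>g x - g y\<bar>"
    if "\<forall>x. \<bar>g x\<bar> \<le> R \<longrightarrow> \<bar>h x\<bar> \<le> M" "\<bar>g x\<bar> \<le> R" "\<bar>g y\<bar> \<le> R" for R M x y
    using primitive_lipschitz_extend[OF F, of R M "Pt x" "Pt y"] that by simp
  have "isCont F x" if "isCont g x" for x
  proof -
    obtain M where M: "\<forall>z. \<bar>g z\<bar> \<le> \<bar>g x\<bar> + 1 \<longrightarrow> \<bar>h z\<bar> \<le> M"
      using adm by blast
    have g_lim: "(g \<longlongrightarrow> g x) (at x)"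
      using that by (simp add: isCont_def)
    have "((\<lambda>y. M * \<bar>g y - g x\<bar>) \<longlongrightarrow> 0) (at x)"
      using g_lim by (auto intro!: tendsto_eq_intros)
    moreover have "eventually (\<lambda>y. \<bar>g y - g x\<bar> < 1) (at x)"
      using tendstoD[OF g_lim, of 1] by (simp add: dist_real_def)
    then have "eventually (\<lambda>y. norm (F y - F x) \<le> M * \<bar>g y - g x\<bar>) (at x)"
      by eventually_elim (use lip[OF M] in auto)
    ultimately have "((\<lambda>y. F y - F x) \<longlongrightarrow> 0) (at x)"
      by (rule Lim_null_comparison[rotated])
    then show ?thesis
      by (simp add: isCont_def LIM_zero_iff)
  qed
  then have "continuous_on (- {x. \<not> isCont g x}) F"
    by (auto intro: continuous_at_imp_continuous_on)
  then show "F \<in> borel_measurable borel"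
    using g by (auto simp: derivator_def intro: borel_measurable_continuous_countable_exceptions
        dest: mono_ctble_discont)
  fix R
  \<comment> \<open>The maximum brings the reference point 0 into range; the bound at 0 also yields
    \<open>0 \<le> M\<close>.\<close>
  obtain M where M: "\<forall>z. \<bar>g z\<bar> \<le> max R \<bar>g 0\<bar> \<longrightarrow> \<bar>h z\<bar> \<le> M"
    using adm by blast
  show "\<exists>M. \<forall>x. \<bar>g x\<bar> \<le> R \<longrightarrow> \<bar>F x\<bar> \<le> M"
  proof (intro exI allI impI)
    fix x
    assume x: "\<bar>g x\<bar> \<le> R"
    then have "\<bar>F x - F 0\<bar> \<le> M * \<bar>g x - g 0\<bar>"
      by (intro lip[OF M]) auto
    also have "\<dots> \<le> M * (R + \<bar>g 0\<bar>)"
      using x M[rule_format, of 0] by (intro mult_left_mono) auto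
    finally show "\<bar>F x\<bar> \<le> M * (R + \<bar>g 0\<bar>) + \<bar>F 0\<bar>"
      by linarith
  qed
qed

text \<open>The strict inequality on the right keeps the points found for adjacent intervals
  \<open>g\<close>-distinct. It can be demanded because the points at which \<open>g\<close> already has its final value
  form a null set.\<close>

lemma exists_nonpos_left_of:
  fixes h :: "real \<Rightarrow> real"
  assumes less: "extend g p < extend g q"
    and int: "set_integrable (LS_measure g) (below q - below p) h"
    and le: "(LINT t:below q - below p|LS_measure g. h t) \<le> 0"
  shows "\<exists>z. extend g p \<le> g z \<and> g z < extend g q \<and> h z \<le> 0"
proof (rule ccontr)
  assume neg: "\<not> ?thesis"
  let ?I = "below q - below p" and ?N = "{z \<in> below q. g z = extend g q}"
  \<comment> \<open>\<open>?N\<close> is upward closed in \<open>below q\<close>, so its rational points and its minimum, if there is one,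
    suffice to cover it by sets \<open>below q - below (Pt r)\<close>.\<close>
  define C where "C = {r \<in> ?N. r \<in> \<rat> \<or> (\<forall>z\<in>?N. r \<le> z)}"
  have sub: "below p \<subseteq> below q"
    using less by (rule below_subset_of_less)
  have g_le: "extend g p \<le> g z" "g z \<le> extend g q" if "z \<in> ?I" for z
  proof -
    have "below p \<subseteq> below (Pt z)" "below (Pt z) \<subseteq> below q"
      using that by (cases p; cases q; auto)+
    from measure_below_diff(2)[OF this(1)] measure_below_diff(2)[OF this(2)]
    show "extend g p \<le> g z" "g z \<le> extend g q"
      by simp_all
  qed
  have "countable C"
  proof -
    have "C \<subseteq> \<rat> \<union> {THE r. r \<in> ?N \<and> (\<forall>z\<in>?N. r \<le> z)}"
    proof
      fix r
      assume "r \<in> C"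
      moreover have "r = (THE r. r \<in> ?N \<and> (\<forall>z\<in>?N. r \<le> z))" if "r \<in> ?N" "\<forall>z\<in>?N. r \<le> z"
        by (rule the_equality[symmetric]) (use that in \<open>auto intro: antisym\<close>)
      ultimately show "r \<in> \<rat> \<union> {THE r. r \<in> ?N \<and> (\<forall>z\<in>?N. r \<le> z)}"
        unfolding C_def by blast
    qed
    then show ?thesis
      by (rule countable_subset) (simp add: countable_rat)
  qed
  have "below q - below (Pt r) \<in> null_sets (LS_measure g)" if "r \<in> C" for r
  proof -
    have "below (Pt r) \<subseteq> below q" "g r = extend g q"
      using that unfolding C_def by (cases q; auto)+
    then show ?thesis
      using measure_below_diff(1)[of "Pt r" q] by (intro null_setsI) auto
  qed
  then have null: "(\<Union>r\<in>C. below q - below (Pt r)) \<in> null_sets (LS_measure g)"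
    using \<open>countable C\<close> by (intro null_sets_UN') auto
  have N: "?N \<subseteq> (\<Union>r\<in>C. below q - below (Pt r))"
  proof
    fix z
    assume z: "z \<in> ?N"
    show "z \<in> (\<Union>r\<in>C. below q - below (Pt r))"
    proof (cases "z \<in> C")
      case True
      then show ?thesis
        using z by (auto intro!: bexI[of _ z])
    next
      case False
      \<comment> \<open>\<open>z\<close> is not minimal in \<open>?N\<close>. A rational
        \<open>r\<close> between \<open>w\<close> and \<open>z\<close> lies in \<open>?N\<close>
        too, since \<open>g\<close> is constant from \<open>w\<close> to \<open>z\<close>.\<close>
      then obtain w where w: "w \<in> ?N" "w < z"
        using z unfolding C_def by fastforce
      then obtain r where r: "r \<in> \<rat>" "w < r" "r < z"
        using Rats_dense_in_real by blast
      have "r \<in> below q"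
        using r z by (cases q) auto
      moreover have "g r = extend g q"
        using derivator_mono[of w r] derivator_mono[of r z] r w z by simp
      ultimately have "r \<in> C"
        using r by (simp add: C_def)
      then show ?thesis
        using r z by (auto intro!: bexI[of _ r])
    qed
  qed
  have pos: "AE z in LS_measure g. z \<in> ?I \<longrightarrow> 0 < h z"
    using AE_not_in[OF null]
  proof eventually_elim
    case (elim z)
    show ?case
    proof
      assume z: "z \<in> ?I"
      then have "z \<notin> ?N"
        using elim N by blast
      then have "g z < extend g q" "extend g p \<le> g z"
        using g_le[OF z] z by auto
      then show "0 < h z"
        using neg by force
    qed
  qed
  have int': "integrable (LS_measure g) (\<lambda>z. indicator ?I z *\<^sub>R h z)"
    using int by (simp add: set_integrable_def)
  have nonneg: "AE z in LS_measure g. 0 \<le> indicator ?I z *\<^sub>R h z"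
    using pos by eventually_elim (auto simp: indicator_def)
  have "0 \<le> (LINT t:?I|LS_measure g. h t)"
    unfolding set_lebesgue_integral_def by (rule integral_nonneg_AE[OF nonneg])
  with le have "(LINT t:?I|LS_measure g. h t) = 0"
    by simp
  then have "AE z in LS_measure g. indicator ?I z *\<^sub>R h z = 0"
    using integral_nonneg_eq_0_iff_AE[OF int' nonneg] by (simp add: set_lebesgue_integral_def)
  \<comment> \<open>\<open>h\<close> vanishes almost everywhere on \<open>?I\<close> and is positive
    there, so \<open>?I\<close> is null, although its measure is the positive increment of
    \<open>g\<close>.\<close>
  with pos have "AE z in LS_measure g. z \<notin> ?I"
    by eventually_elim (auto simp: indicator_def)
  moreover have "?I \<in> sets (LS_measure g)"
    by simp
  ultimately have "emeasure (LS_measure g) ?I = 0"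
    using AE_iff_null_sets by blast
  then show False
    using measure_below_diff(1)[OF sub] less by simp
qed

end

section \<open>The monomials\<close>

context
  fixes g :: "real \<Rightarrow> real" and x0 :: real
  assumes g: "derivator g"
begin

declare g_monomial.simps [simp del]

abbreviation gm :: "nat \<Rightarrow> point \<Rightarrow> real" where
  "gm k p \<equiv> extend (g_monomial g x0 k) p"

section \<open>Increments and regularity of the monomials\<close>

lemma gm_0: "gm 0 p = 1"
  by (cases p) (simp_all add: g_monomial.simps tendsto_Lim)

lemma primitive_g_monomial:
  "primitive g (\<lambda>x. Suc k * g_monomial g x0 k x) (g_monomial g x0 (Suc k))"
proof -
  \<comment> \<open>Conditional on admissibility in degree \<open>k\<close>, so that it can drive
    the induction for \<open>adm\<close>, which then discharges the condition.\<close>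
  have *: "primitive g (\<lambda>x. Suc k * g_monomial g x0 k x) (g_monomial g x0 (Suc k))"
    if h: "admissible g (g_monomial g x0 k)" for k
    unfolding primitive_def
  proof (intro conjI allI impI)
    show "admissible g (\<lambda>x. Suc k * g_monomial g x0 k x)"
      unfolding admissible_def
    proof (intro conjI allI)
      show "(\<lambda>x. Suc k * g_monomial g x0 k x) \<in> borel_measurable borel"
        using h by (auto simp: admissible_def)
      fix R
      obtain M where "\<And>x. \<bar>g x\<bar> \<le> R \<Longrightarrow> \<bar>g_monomial g x0 k x\<bar> \<le> M"
        using h unfolding admissible_def by blast
      then show "\<exists>M. \<forall>x. \<bar>g x\<bar> \<le> R \<longrightarrow> \<bar>Suc k * g_monomial g x0 k x\<bar> \<le> M"
        by (intro exI[of _ "Suc k * M"]) (simp add: abs_mult mult_left_mono)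
    qed
    fix a b :: real
    assume "a \<le> b"
    then show "g_monomial g x0 (Suc k) b - g_monomial g x0 (Suc k) a =
        (LINT t:{a..<b}|LS_measure g. Suc k * g_monomial g x0 k t)"
      using primitive_g_integral[OF g h, of x0]
      by (simp add: primitive_def g_monomial.simps right_diff_distrib[symmetric] del: of_nat_Suc)
  qed
  have adm: "admissible g (g_monomial g x0 k)" for k
  proof (induction k)
    case 0
    show ?case
      by (auto simp: admissible_def g_monomial.simps)
  next
    case (Suc k)
    then show ?case
      by (rule primitive_admissible[OF g *])
  qed
  show "primitive g (\<lambda>x. Suc k * g_monomial g x0 k x) (g_monomial g x0 (Suc k))"
    by (rule *[OF adm])
qed

lemma gm_tendsto: "(g_monomial g x0 k \<longlongrightarrow> gm k (Plus t)) (at_right t)"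
proof (cases k)
  case 0
  then show ?thesis
    using gm_0[of "Plus t"] by (simp add: g_monomial.simps)
qed (use primitive_tendsto_extend[OF g primitive_g_monomial] in simp)

lemma gm_Suc_diff:
  assumes "below p \<subseteq> below q"
  shows "gm (Suc k) q - gm (Suc k) p = (LINT t:below q - below p|LS_measure g. Suc k * g_monomial g x0 k t)"
    and "set_integrable (LS_measure g) (below q - below p) (g_monomial g x0 k)"
  using primitive_extend_diff[OF g primitive_g_monomial assms, of k] by simp_all

text \<open>The first monomial is \<open>g\<close> up to a constant, hence Lipschitz without any
  bound on \<open>g\<close>; this serves the case \<open>n \<le> 1\<close> of uniform
  continuity.\<close>

lemma gm_1_diff: "gm 1 p - gm 1 q = extend g p - extend g q"
proof -
  have "gm 1 q - gm 1 p = extend g q - extend g p" if "below p \<subseteq> below q" for p q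
    using primitive_extend_diff(1)[OF g primitive_g[OF g] that] gm_Suc_diff(1)[OF that, of 0]
    by (simp add: g_monomial.simps)
  from this[of p q] this[of q p] show ?thesis
    using below_linear[of p q] by linarith
qed

lemma gm_lipschitz:
  "\<exists>L. \<forall>p q. \<bar>extend g p\<bar> \<le> R \<longrightarrow> \<bar>extend g q\<bar> \<le> R \<longrightarrow> \<bar>gm k p - gm k q\<bar> \<le> L * \<bar>extend g p - extend g q\<bar>"
proof (cases k)
  case 0
  then show ?thesis
    by (intro exI[of _ 0]) (simp add: gm_0)
next
  case (Suc j)
  have "admissible g (\<lambda>x. Suc j * g_monomial g x0 j x)"
    using primitive_g_monomial[of j] by (simp add: primitive_def)
  then obtain M where "\<And>x. \<bar>g x\<bar> \<le> R \<Longrightarrow> \<bar>Suc j * g_monomial g x0 j x\<bar> \<le> M"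
    unfolding admissible_def by blast
  from primitive_lipschitz_extend[OF g primitive_g_monomial this] show ?thesis
    unfolding Suc by blast
qed

text \<open>The Lipschitz bound at \<open>g\<close>-distance 0. It lets one point stand for all
  points with the same value of \<open>g\<close>.\<close>

lemma gm_cong:
  assumes "extend g p = extend g q"
  shows "gm k p = gm k q"
proof -
  obtain L where "\<bar>gm k p - gm k q\<bar> \<le> L * \<bar>extend g p - extend g q\<bar>"
    using gm_lipschitz[of "\<bar>extend g p\<bar>" k] assms by (metis order_refl)
  then show ?thesis
    using assms by simp
qed

text \<open>At a jump of \<open>g\<close> the derivative can change sign without vanishing, so the induction
  runs over weak sign alternations instead of zeros.\<close>

lemma alternating_leading_coeff:
  fixes c :: "nat \<Rightarrow> real"
  assumes "\<And>i. i < n \<Longrightarrow> extend g (y i) < extend g (y (Suc i))"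
    and "\<And>i. i \<le> n \<Longrightarrow> (-1) ^ (n + i) * (\<Sum>k\<le>n. c k * gm k (y i)) \<le> 0"
  shows "c n < 0 \<or> (\<forall>k\<le>n. c k = 0)"
  using assms
proof (induction n arbitrary: c y)
  case 0
  from "0.prems"(2)[of 0] show ?case
    by (auto simp: gm_0)
next
  case (Suc m)
  \<comment> \<open>The coefficients of the \<open>g\<close>-derivative: the monomial of degree
    \<open>Suc k\<close> has derivative \<open>Suc k\<close> times the one of degree
    \<open>k\<close>.\<close>
  define e where "e k = c (Suc k) * Suc k" for k
  have step: "\<exists>z. extend g (y i) \<le> g z \<and> g z < extend g (y (Suc i)) \<and>
      (-1) ^ (m + i) * (\<Sum>k\<le>m. e k * g_monomial g x0 k z) \<le> 0" if i: "i \<le> m" for i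
  proof -
    let ?S = "below (y (Suc i)) - below (y i)"
    have less: "extend g (y i) < extend g (y (Suc i))"
      using Suc.prems(1) i by simp
    have sub: "below (y i) \<subseteq> below (y (Suc i))"
      by (rule below_subset_of_less[OF g less])
    define s :: real where "s = (-1) ^ (m + i)"
    define h where "h t = (\<Sum>k\<le>m. (s * e k) * g_monomial g x0 k t)" for t
    have h: "set_integrable (LS_measure g) ?S h"
      "(LINT t:?S|LS_measure g. h t) = (\<Sum>k\<le>m. (s * e k) * (LINT t:?S|LS_measure g. g_monomial g x0 k t))"
      unfolding h_def
      using set_integral_lincomb[of "{..m}" "LS_measure g" ?S "g_monomial g x0" "\<lambda>k. s * e k"]
        gm_Suc_diff(2)[OF sub] by simp_all
    have "(LINT t:?S|LS_measure g. h t) = s * (\<Sum>k\<le>m. c (Suc k) * (gm (Suc k) (y (Suc i)) - gm (Suc k) (y i)))"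
      unfolding h(2) gm_Suc_diff(1)[OF sub] e_def set_integral_mult_right
      by (simp only: sum_distrib_left mult.assoc)
    also have "\<dots> = s * ((\<Sum>k\<le>Suc m. c k * gm k (y (Suc i))) - (\<Sum>k\<le>Suc m. c k * gm k (y i)))"
      unfolding sum.atMost_Suc_shift
      by (simp add: gm_0 sum_subtractf right_diff_distrib)
    \<comment> \<open>\<open>Suc m + Suc i\<close> has the parity of \<open>m + i\<close> and
      \<open>Suc m + i\<close> the opposite one, so the difference becomes a sum of two terms that
      are nonpositive by hypothesis.\<close>
    also have "\<dots> = (-1) ^ (Suc m + Suc i) * (\<Sum>k\<le>Suc m. c k * gm k (y (Suc i))) +
        (-1) ^ (Suc m + i) * (\<Sum>k\<le>Suc m. c k * gm k (y i))"
      by (simp add: s_def right_diff_distrib del: sum.atMost_Suc)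
    also have "\<dots> \<le> 0"
      using Suc.prems(2)[of i] Suc.prems(2)[of "Suc i"] i by (intro add_nonpos_nonpos) auto
    finally have "(LINT t:?S|LS_measure g. h t) \<le> 0" .
    from exists_nonpos_left_of[OF g less h(1) this] show ?thesis
      unfolding h_def s_def by (simp add: sum_distrib_left mult.assoc)
  qed
  then obtain z where z: "\<And>i. i \<le> m \<Longrightarrow> extend g (y i) \<le> g (z i)"
      "\<And>i. i \<le> m \<Longrightarrow> g (z i) < extend g (y (Suc i))"
      "\<And>i. i \<le> m \<Longrightarrow> (-1) ^ (m + i) * (\<Sum>k\<le>m. e k * g_monomial g x0 k (z i)) \<le> 0"
    by metis
  have "e m < 0 \<or> (\<forall>k\<le>m. e k = 0)"
  proof (rule Suc.IH[of "\<lambda>i. Pt (z i)"])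
    fix i
    assume "i < m"
    \<comment> \<open>The strict upper bound for \<open>z i\<close> and the weak lower bound for
      \<open>z (Suc i)\<close> meet at \<open>y (Suc i)\<close>.\<close>
    then show "extend g (Pt (z i)) < extend g (Pt (z (Suc i)))"
      using z(2)[of i] z(1)[of "Suc i"] by simp
  qed (use z(3) in simp)
  then show ?case
  proof
    assume "e m < 0"
    then show ?thesis
      by (simp add: e_def mult_less_0_iff del: of_nat_Suc)
  next
    assume "\<forall>k\<le>m. e k = 0"
    then have c: "c (Suc k) = 0" if "k \<le> m" for k
      using that by (simp add: e_def del: of_nat_Suc)
    then have sum: "(\<Sum>k\<le>Suc m. c k * gm k p) = c 0" for p
      unfolding sum.atMost_Suc_shift by (simp add: gm_0)
    \<comment> \<open>The polynomial is the constant \<open>c 0\<close>, and the last two points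
      impose opposite weak signs on it.\<close>
    have "c 0 = 0"
      using Suc.prems(2)[of "Suc m"] Suc.prems(2)[of m] unfolding sum by simp
    with c have "c k = 0" if "k \<le> Suc m" for k
      using that by (cases k) auto
    then show ?thesis
      by blast
  qed
qed

section \<open>Independence and interpolation over the reals\<close>

lemma gm_independent_real:
  fixes c :: "nat \<Rightarrow> real"
  assumes inj: "inj_on (\<lambda>i. extend g (y i)) {..n}"
    and zero: "\<And>i. i \<le> n \<Longrightarrow> (\<Sum>k\<le>n. c k * gm k (y i)) = 0"
    and k: "k \<le> n"
  shows "c k = 0"
proof -
  \<comment> \<open>Sorting the values of \<open>g\<close> gives the reindexing \<open>s\<close>
    along which they increase, as the alternation lemma demands.\<close>
  define xs where "xs = sorted_list_of_set ((\<lambda>i. extend g (y i)) ` {..n})"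
  have len: "length xs = Suc n"
    using inj by (simp add: xs_def card_image)
  have "\<exists>i\<le>n. extend g (y i) = xs ! j" if "j \<le> n" for j
  proof -
    have "xs ! j \<in> set xs"
      using that len by (intro nth_mem) simp
    then show ?thesis
      by (auto simp: xs_def)
  qed
  then obtain s where s: "\<And>j. j \<le> n \<Longrightarrow> s j \<le> n" "\<And>j. j \<le> n \<Longrightarrow> extend g (y (s j)) = xs ! j"
    by metis
  have less: "extend g (y (s j)) < extend g (y (s (Suc j)))" if "j < n" for j
    using that s len sorted_wrt_nth_less[of "(<)" xs j "Suc j"] by (simp add: xs_def)
  have "c n < 0 \<or> (\<forall>k\<le>n. c k = 0)"
    by (rule alternating_leading_coeff[of n "\<lambda>j. y (s j)"])
      (simp_all add: less zero s(1))
  moreover have "- c n < 0 \<or> (\<forall>k\<le>n. - c k = 0)"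
    by (rule alternating_leading_coeff[of n "\<lambda>j. y (s j)" "\<lambda>k. - c k"])
      (simp_all add: less zero s(1) sum_negf)
  ultimately show ?thesis
    using k by auto
qed

text \<open>Newton's scheme: an interpolant at the first \<open>m\<close> points is corrected at
  \<open>y m\<close> by a multiple of a polynomial that vanishes at those points.\<close>

lemma gm_interpolation_real:
  fixes b :: "nat \<Rightarrow> real"
  assumes "inj_on (\<lambda>i. extend g (y i)) {..<m}"
  shows "\<exists>c. \<forall>i<m. (\<Sum>k<m. c k * gm k (y i)) = b i"
  using assms
proof (induction m arbitrary: b)
  case 0
  show ?case
    by simp
next
  case (Suc m)
  then have inj: "inj_on (\<lambda>i. extend g (y i)) {..<m}"
    by (auto intro: inj_on_subset)
  obtain c where c: "\<And>i. i < m \<Longrightarrow> (\<Sum>k<m. c k * gm k (y i)) = b i"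
    using Suc.IH[OF inj] by blast
  obtain e where e: "\<And>i. i < m \<Longrightarrow> (\<Sum>k<m. e k * gm k (y i)) = gm m (y i)"
    using Suc.IH[OF inj, of "\<lambda>i. gm m (y i)"] by blast
  \<comment> \<open>The monomial of degree \<open>m\<close> minus its interpolant: zero at the first
    \<open>m\<close> points, with leading coefficient 1. A zero at \<open>y m\<close> as well would
    contradict independence.\<close>
  define q where "q i = gm m (y i) - (\<Sum>k<m. e k * gm k (y i))" for i
  have "q m \<noteq> 0"
  proof
    assume q: "q m = 0"
    define a where "a k = (if k = m then 1 else - e k)" for k
    have a: "(\<Sum>k\<le>m. a k * gm k (y i)) = q i" for i
      unfolding lessThan_Suc_atMost[symmetric] sum.lessThan_Suc
      by (simp add: a_def q_def sum_negf cong: sum.cong_simp)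
    have "a m = 0"
    proof (rule gm_independent_real[of y m])
      show "inj_on (\<lambda>i. extend g (y i)) {..m}"
        using Suc.prems by (simp add: lessThan_Suc_atMost)
      show "(\<Sum>k\<le>m. a k * gm k (y i)) = 0" if "i \<le> m" for i
        unfolding a using that q e by (cases "i = m") (auto simp: q_def)
    qed simp
    then show False
      by (simp add: a_def)
  qed
  define r where "r = (b m - (\<Sum>k<m. c k * gm k (y m))) / q m"
  define a where "a k = (if k = m then r else c k - r * e k)" for k
  have a: "(\<Sum>k<Suc m. a k * gm k (y i)) = (\<Sum>k<m. c k * gm k (y i)) + r * q i" for i
    by (simp add: a_def q_def sum_subtractf left_diff_distrib right_diff_distrib sum_distrib_left
        mult.assoc cong: sum.cong_simp)
  show ?case
  proof (intro exI allI impI)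
    fix i
    assume "i < Suc m"
    then consider "i < m" | "i = m"
      by linarith
    then show "(\<Sum>k<Suc m. a k * gm k (y i)) = b i"
    proof cases
      case 1
      then show ?thesis
        unfolding a using c e by (simp add: q_def)
    next
      case 2
      then show ?thesis
        unfolding a using \<open>q m \<noteq> 0\<close> by (simp add: r_def)
    qed
  qed
qed

section \<open>Transfer from the reals to the scalar field\<close>

text \<open>The two identities say that \<open>l\<close>, up to transposition, inverts the
  Vandermonde matrix from both sides. Being real, it embeds by \<open>of_real\<close>, so sign
  arguments are confined to real coefficients.\<close>

lemma lagrange_coeffs:
  assumes inj: "inj_on (\<lambda>i. extend g (y i)) {..<m}"
  obtains l :: "nat \<Rightarrow> nat \<Rightarrow> real"
  where "\<And>i j. i < m \<Longrightarrow> (\<Sum>k<m. l j k * gm k (y i)) = (if i = j then 1 else 0)"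
    and "\<And>k i. k < m \<Longrightarrow> i < m \<Longrightarrow> (\<Sum>j<m. l j k * gm i (y j)) = (if i = k then 1 else 0)"
proof -
  have "\<forall>j. \<exists>c. \<forall>i<m. (\<Sum>k<m. c k * gm k (y i)) = (if i = j then 1 else 0)"
    by (intro allI gm_interpolation_real[OF inj])
  then obtain l where l: "\<And>i j. i < m \<Longrightarrow> (\<Sum>k<m. l j k * gm k (y i)) = (if i = j then 1 else 0)"
    by metis
  have "(\<Sum>j<m. l j k * gm i (y j)) = (if i = k then 1 else 0)" if k: "k < m" and i: "i < m" for k i
  proof -
    obtain n where n: "m = Suc n"
      using k by (cases m) auto
    \<comment> \<open>The Lagrange interpolant of the monomial of degree \<open>i\<close>, minus
      that monomial. It vanishes at all \<open>m\<close> points, so its coefficients are 0.\<close>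
    define c where "c k = (\<Sum>j<m. l j k * gm i (y j)) - (if i = k then 1 else 0)" for k
    have "c k = 0"
    proof (rule gm_independent_real[of y n])
      show "inj_on (\<lambda>i. extend g (y i)) {..n}"
        using inj by (simp add: n lessThan_Suc_atMost)
      show "k \<le> n"
        using k n by simp
      fix i'
      assume "i' \<le> n"
      then have i': "i' < m"
        by (simp add: n)
      have "(\<Sum>k<m. (\<Sum>j<m. l j k * gm i (y j)) * gm k (y i')) =
          (\<Sum>k<m. \<Sum>j<m. gm i (y j) * (l j k * gm k (y i')))"
        by (simp add: sum_distrib_left mult_ac)
      also have "\<dots> = (\<Sum>j<m. gm i (y j) * (\<Sum>k<m. l j k * gm k (y i')))"
        by (subst sum.swap) (simp add: sum_distrib_left)
      also have "\<dots> = gm i (y i')"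
        using i' by (simp add: l if_distrib[of "\<lambda>u. _ * u"] cong: if_cong)
      finally have "(\<Sum>k<m. (\<Sum>j<m. l j k * gm i (y j)) * gm k (y i')) = gm i (y i')" .
      moreover have "(\<Sum>k<m. (if i = k then 1 else 0) * gm k (y i')) = gm i (y i')"
        using i by (simp add: if_distrib[of "\<lambda>u. u * _"] cong: if_cong)
      ultimately show "(\<Sum>k\<le>n. c k * gm k (y i')) = 0"
        unfolding c_def left_diff_distrib sum_subtractf
        by (simp only: n lessThan_Suc_atMost)
    qed
    then show ?thesis
      by (simp add: c_def)
  qed
  with l show ?thesis
    by (rule that)
qed

lemma gm_interpolation:
  fixes b :: "nat \<Rightarrow> 'a::real_normed_field"
  assumes inj: "inj_on (\<lambda>i. extend g (y i)) {..<m}"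
  shows "\<exists>c. \<forall>i<m. (\<Sum>k<m. c k * of_real (gm k (y i))) = b i"
proof -
  obtain l where l: "\<And>i j. i < m \<Longrightarrow> (\<Sum>k<m. l j k * gm k (y i)) = (if i = j then 1 else 0)"
    using lagrange_coeffs[OF inj] by metis
  show ?thesis
  proof (intro exI allI impI)
    fix i
    assume i: "i < m"
    have "(\<Sum>k<m. (\<Sum>j<m. b j * of_real (l j k)) * of_real (gm k (y i))) =
        (\<Sum>k<m. \<Sum>j<m. b j * of_real (l j k * gm k (y i)))"
      by (simp add: sum_distrib_right mult.assoc)
    also have "\<dots> = (\<Sum>j<m. b j * of_real (\<Sum>k<m. l j k * gm k (y i)))"
      by (subst sum.swap) (simp add: sum_distrib_left)
    also have "\<dots> = b i"
      using i by (simp add: l if_distrib[of of_real] if_distrib[of "\<lambda>u. _ * u"]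
          cong: if_cong)
    finally show "(\<Sum>k<m. (\<Sum>j<m. b j * of_real (l j k)) * of_real (gm k (y i))) = b i" .
  qed
qed

lemma gm_independent:
  fixes c :: "nat \<Rightarrow> 'a::real_normed_field"
  assumes inj: "inj_on (\<lambda>i. extend g (y i)) {..<m}"
    and zero: "\<And>i. i < m \<Longrightarrow> (\<Sum>k<m. c k * of_real (gm k (y i))) = 0"
    and k: "k < m"
  shows "c k = 0"
proof -
  obtain l where l: "\<And>k i. k < m \<Longrightarrow> i < m \<Longrightarrow> (\<Sum>j<m. l j k * gm i (y j)) = (if i = k then 1 else 0)"
    using lagrange_coeffs[OF inj] by metis
  have "0 = (\<Sum>j<m. of_real (l j k) * (\<Sum>i<m. c i * of_real (gm i (y j))))"
    by (simp add: zero)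
  also have "\<dots> = (\<Sum>j<m. \<Sum>i<m. c i * of_real (l j k * gm i (y j)))"
    by (simp add: sum_distrib_left mult_ac)
  also have "\<dots> = (\<Sum>i<m. c i * of_real (\<Sum>j<m. l j k * gm i (y j)))"
    by (subst sum.swap) (simp add: sum_distrib_left)
  also have "\<dots> = c k"
    using k by (simp add: l if_distrib[of of_real] if_distrib[of "\<lambda>u. _ * u"]
        cong: if_cong)
  finally show ?thesis
    by simp
qed

section \<open>The Haar condition and uniform continuity over a set of points\<close>

text \<open>\<open>extend\<close> commutes with linear combinations of the monomials because their
  right-hand limits exist, by \<open>gm_tendsto\<close>.\<close>

lemma g_polys_on_eq:
  "(g_polys_on g x0 n X :: (point \<Rightarrow> 'a::real_normed_field) set) =
     range (\<lambda>c. restr X (\<lambda>p. \<Sum>k\<le>n. c k * of_real (gm k p)))"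
proof -
  have *: "extend (\<lambda>x. \<Sum>k\<le>n. c k * of_real (g_monomial g x0 k x)) =
      (\<lambda>p. \<Sum>k\<le>n. c k * of_real (gm k p))" for c :: "nat \<Rightarrow> 'a"
  proof
    fix p
    show "extend (\<lambda>x. \<Sum>k\<le>n. c k * of_real (g_monomial g x0 k x)) p =
        (\<Sum>k\<le>n. c k * of_real (gm k p))"
    proof (cases p)
      case (Plus t)
      have "((\<lambda>x. \<Sum>k\<le>n. c k * of_real (g_monomial g x0 k x)) \<longlongrightarrow>
          (\<Sum>k\<le>n. c k * of_real (gm k p))) (at_right t)"
        unfolding Plus
        by (rule tendsto_sum) (rule tendsto_mult[OF tendsto_const tendsto_of_real[OF gm_tendsto]])
      then show ?thesis
        unfolding Plus by (simp add: tendsto_Lim)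
    qed simp
  qed
  then show ?thesis
    unfolding g_polys_on_def g_polys_def fun_vs_span_image[OF finite_atMost] image_image
    by (simp add: *)
qed

lemma g_polys_on_span:
  "(g_polys_on g x0 n X :: (point \<Rightarrow> 'a::real_normed_field) set) =
     fun_vs.span ((\<lambda>k. restr X (\<lambda>p. of_real (gm k p))) ` {..n})"
  unfolding g_polys_on_eq fun_vs_span_image[OF finite_atMost]
  by (intro image_cong refl) (auto simp: restr_def fun_eq_iff)

lemma haar_condition_g_polys_on:
  "haar_condition g X (g_polys_on g x0 n X :: (point \<Rightarrow> 'a::real_normed_field) set)"
proof -
  let ?Y = "g_polys_on g x0 n X :: (point \<Rightarrow> 'a) set"
  define V where "V = extend g ` X"
  have sub: "fun_vs.subspace ?Y"
    unfolding g_polys_on_span by (rule fun_vs.subspace_span)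
  \<comment> \<open>Either \<open>n + 1\<close> points determine all coefficients, or the
    \<open>d\<close> points exhaust the values of \<open>g\<close> on \<open>X\<close> and determine
    only the restriction to \<open>X\<close>.\<close>
  have main: "bij_betw (vandermonde d y) ?Y (fun_on {..<d})" "fun_vs.dim ?Y = d"
    if y: "\<forall>i<d. y i \<in> X" "inj_on (\<lambda>i. extend g (y i)) {..<d}"
      and d: "d = Suc n \<or> d \<le> n \<and> finite V \<and> card V = d" for d y
  proof -
    have zero: "f = 0" if f: "f \<in> ?Y" "\<And>i. i < d \<Longrightarrow> f (y i) = 0" for f
    proof -
      obtain c where c: "f = restr X (\<lambda>p. \<Sum>k\<le>n. c k * of_real (gm k p))"
        using f(1) unfolding g_polys_on_eq by blast
      have fy: "(\<Sum>k\<le>n. c k * of_real (gm k (y i))) = 0" if "i < d" for i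
        using f(2)[OF that] y(1) that by (simp add: c restr_def)
      have "(\<Sum>k\<le>n. c k * of_real (gm k p)) = 0" if p: "p \<in> X" for p
        using d
      proof
        assume d: "d = Suc n"
        have "c k = 0" if "k \<le> n" for k
          by (rule gm_independent[OF y(2)])
            (use that fy d in \<open>auto simp: lessThan_Suc_atMost\<close>)
        then show ?thesis
          by simp
      next
        assume d: "d \<le> n \<and> finite V \<and> card V = d"
        then have "(\<lambda>i. extend g (y i)) ` {..<d} = V"
          using y by (intro card_subset_eq) (auto simp: V_def card_image)
        then obtain i where "i < d" "extend g p = extend g (y i)"
          using p unfolding V_def by blast
        then show ?thesis
          using fy[of i] gm_cong[of p "y i"] by simp
      qed
      then show ?thesis
        by (auto simp: c restr_def fun_eq_iff)
    qed
    have interp: "\<exists>f\<in>?Y. \<forall>i<d. f (y i) = b i" for b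
    proof -
      obtain c where c: "\<And>i. i < d \<Longrightarrow> (\<Sum>k<d. c k * of_real (gm k (y i))) = b i"
        using gm_interpolation[OF y(2)] by blast
      \<comment> \<open>The first \<open>d\<close> monomials already interpolate;
        \<open>d \<le> Suc n\<close> leaves room to pad with zeros.\<close>
      define f where "f = restr X (\<lambda>p. \<Sum>k\<le>n. (if k < d then c k else 0) * of_real (gm k p))"
      have "(\<Sum>k\<le>n. (if k < d then c k else 0) * of_real (gm k p)) = (\<Sum>k<d. c k * of_real (gm k p))" for p
        by (rule sum.mono_neutral_cong_right) (use d in auto)
      then have "\<forall>i<d. f (y i) = b i"
        using y(1) c by (simp add: f_def restr_def)
      moreover have "f \<in> ?Y"
        unfolding g_polys_on_eq f_def by (rule rangeI)
      ultimately show ?thesis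
        by blast
    qed
    show "bij_betw (vandermonde d y) ?Y (fun_on {..<d})" "fun_vs.dim ?Y = d"
      by (rule unisolvent[OF sub zero interp]; assumption)+
  qed
  \<comment> \<open>One choice of points realizing the values in \<open>W\<close> is enough to
    compute the dimension as \<open>card W\<close>; \<open>main\<close> then applies to every family
    of that size.\<close>
  obtain W where W: "W \<subseteq> V" "finite W"
    "card W = Suc n \<or> card W \<le> n \<and> finite V \<and> card V = card W"
  proof (cases "finite V \<and> card V \<le> n")
    case True
    then show ?thesis
      using that[of V] by simp
  next
    case False
    then obtain W where "W \<subseteq> V" "card W = Suc n" "finite W"
    proof (cases "finite V")
      case True
      then show ?thesis
        using False that obtain_subset_with_card_n[of "Suc n" V] by (metis not_less_eq_eq)
    next
      case False
      then show ?thesis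
        using that infinite_arbitrarily_large[of V "Suc n"] by blast
    qed
    then show ?thesis
      using that[of W] by simp
  qed
  obtain v where v: "bij_betw v {..<card W} W"
    using ex_bij_betw_nat_finite[OF W(2)] by (auto simp: atLeast0LessThan)
  have "\<exists>p\<in>X. extend g p = v i" if "i < card W" for i
  proof -
    have "v i \<in> V"
      using bij_betwE[OF v] W(1) that by auto
    then show ?thesis
      by (auto simp: V_def)
  qed
  then obtain y where y: "\<And>i. i < card W \<Longrightarrow> y i \<in> X" "\<And>i. i < card W \<Longrightarrow> extend g (y i) = v i"
    by metis
  have "inj_on (\<lambda>i. extend g (y i)) {..<card W}"
    using bij_betw_imp_inj_on[OF v] y(2) by (simp add: inj_on_def)
  then have dim: "fun_vs.dim ?Y = card W"
    using y(1) W(3) by (intro main(2)[of _ y]) auto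
  show ?thesis
    unfolding haar_condition_def Let_def dim
  proof (intro conjI allI impI)
    show "?Y \<subseteq> fun_on X"
      unfolding g_polys_on_eq by (auto simp: restr_def fun_on_def)
    show "\<exists>B. finite B \<and> fun_vs.span B = ?Y"
      unfolding g_polys_on_span by blast
    show "fun_vs.subspace ?Y"
      by (rule sub)
  qed (use main(1) W(3) vandermonde_linear in auto)
qed

lemma g_polys_on_UC:
  assumes "n \<le> 1 \<or> bounded (extend g ` X)"
  shows "(g_polys_on g x0 n X :: (point \<Rightarrow> 'a::real_normed_field) set) \<subseteq> UC g X"
proof -
  have "\<exists>L. \<forall>p\<in>X. \<forall>q\<in>X. \<bar>gm k p - gm k q\<bar> \<le> L * \<bar>extend g p - extend g q\<bar>" if k: "k \<le> n" for k
    using assms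
  proof
    assume "n \<le> 1"
    then consider "k = 0" | "k = 1"
      using k by linarith
    then show ?thesis
    proof cases
      case 1
      then show ?thesis
        by (intro exI[of _ 0]) (simp add: gm_0)
    next
      case 2
      then show ?thesis
        by (intro exI[of _ 1] ballI) (simp only: gm_1_diff mult_1 order_refl)
    qed
  next
    assume "bounded (extend g ` X)"
    then obtain R where "\<forall>p\<in>X. \<bar>extend g p\<bar> \<le> R"
      by (auto simp: bounded_iff)
    then show ?thesis
      using gm_lipschitz[of R k] by meson
  qed
  then obtain L where L: "\<And>k p q. k \<le> n \<Longrightarrow> p \<in> X \<Longrightarrow> q \<in> X \<Longrightarrow>
      \<bar>gm k p - gm k q\<bar> \<le> L k * \<bar>extend g p - extend g q\<bar>"
    by metis
  show ?thesis
  proof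
    fix f :: "point \<Rightarrow> 'a"
    assume "f \<in> g_polys_on g x0 n X"
    then obtain c where c: "f = restr X (\<lambda>p. \<Sum>k\<le>n. c k * of_real (gm k p))"
      unfolding g_polys_on_eq by blast
    \<comment> \<open>The absolute value and the added 1 make \<open>K\<close> positive, so that
      \<open>\<epsilon> / K\<close> is a legitimate modulus.\<close>
    define K where "K = \<bar>\<Sum>k\<le>n. norm (c k) * L k\<bar> + 1"
    have lip: "norm (f p - f q) \<le> K * \<bar>extend g p - extend g q\<bar>" if "p \<in> X" "q \<in> X" for p q
    proof -
      have "f p - f q = (\<Sum>k\<le>n. c k * of_real (gm k p - gm k q))"
        using that by (simp add: c restr_def sum_subtractf right_diff_distrib)
      also have "norm \<dots> \<le> (\<Sum>k\<le>n. norm (c k) * (L k * \<bar>extend g p - extend g q\<bar>))"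
      proof (rule sum_norm_le)
        fix k
        assume "k \<in> {..n}"
        then show "norm (c k * of_real (gm k p - gm k q)) \<le> norm (c k) * (L k * \<bar>extend g p - extend g q\<bar>)"
          unfolding norm_mult norm_of_real using L that by (intro mult_left_mono) auto
      qed
      also have "\<dots> = (\<Sum>k\<le>n. norm (c k) * L k) * \<bar>extend g p - extend g q\<bar>"
        by (simp add: sum_distrib_right mult.assoc)
      also have "\<dots> \<le> K * \<bar>extend g p - extend g q\<bar>"
        by (intro mult_right_mono) (auto simp: K_def)
      finally show ?thesis .
    qed
    have K: "K > 0"
      by (simp add: K_def)
    show "f \<in> UC g X"
      unfolding UC_def
    proof (intro CollectI conjI allI impI)
      show "f \<in> fun_on X"
        by (simp add: c restr_def fun_on_def)
      fix \<epsilon> :: real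
      assume "\<epsilon> > 0"
      moreover have "norm (f p - f q) < \<epsilon>"
        if "p \<in> X" "q \<in> X" "\<bar>extend g p - extend g q\<bar> < \<epsilon> / K" for p q
        using lip[OF that(1,2)] that(3) K by (simp add: field_simps)
      ultimately show "\<exists>\<delta>>0. \<forall>p\<in>X. \<forall>q\<in>X. \<bar>extend g p - extend g q\<bar> < \<delta> \<longrightarrow> norm (f p - f q) < \<epsilon>"
        using K by (intro exI[of _ "\<epsilon> / K"]) auto
    qed
  qed
qed

end

text \<open>For \<open>n \<ge> 2\<close> the inclusion in \<open>UC g X\<close> can fail when
  \<open>g\<close> is unbounded on \<open>X\<close>, as \<open>g_polys_not_UC\<close> shows for the
  identity. The interpolation property is therefore asserted over every \<open>X\<close>, and the
  full \<open>g_Haar\<close> where a Lipschitz bound in \<open>g\<close> is available.\<close>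

theorem lemma6p9:
  fixes g :: "real \<Rightarrow> real" and x0 :: real and n :: nat
  assumes "derivator g"
  shows "haar_condition g (Rplus g)
           (g_polys_on g x0 n (Rplus g) :: (point \<Rightarrow> 'a::real_normed_field) set)
       \<and> (\<forall>X \<subseteq> Rplus g.
            haar_condition g X (g_polys_on g x0 n X :: (point \<Rightarrow> 'a) set) \<and>
            (n \<le> 1 \<or> bounded (extend g ` X) \<longrightarrow>
               g_Haar g X (g_polys_on g x0 n X :: (point \<Rightarrow> 'a) set)))"
  by (simp add: g_Haar_def haar_condition_g_polys_on[OF assms] g_polys_on_UC[OF assms])

end
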